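(* Let $m>1$ be an integer, let $r\in\{-(m-1),\ldots,0,\ldots,m-1\}$, and let $\ell\in\{0,\ldots,m-1\}$ be such that $\ell\equiv r \pmod m$. For a positive real number $\beta\notin\mathbb{Z}$ and a positive integer $n$ put $$C_{m,r}(\beta,n)=\frac{1}{m}\sum_{j=0}^{m-1}\csc^{2n}\Big(\frac{j+\beta}{m}\pi\Big)e^{2\pi i rj/m},\qquad C_{m,r}(n)=\frac{1}{m}\sum_{j=1}^{m-1}\csc^{2n}\Big(\frac{j}{m}\pi\Big)e^{2\pi i rj/m},$$ and define the generating functions $$f_{m,r}(s,\beta)=\sum_{n=0}^{\infty}C_{m,r}(\beta,n+1)s^n,\qquad f_{m,r}(s)=\sum_{n=0}^{\infty}C_{m,r}(n+1)s^n .$$ Then for all complex $s$ with $|s|$ sufficiently small the series defining $f_{m,r}(s,\beta)$ converges uniformly and absolutely, $f_{m,r}(s,\beta)$ admits a meromorphic continuation to all $s\in\mathbb{C}$, and $$f_{m,r}(s,\beta)=2e^{-2\pi i\beta\ell/m}\cdot\frac{U_{m-\ell-1}(1-2s)+e^{2\pi i\beta}U_{\ell-1}(1-2s)}{T_m(1-2s)-\cos 2\pi\beta}.$$ Similarly, for all complex $s$ with $|s|$ sufficiently small the series defining $f_{m,r}(s)$ converges uniformly and absolutely, $f_{m,r}(s)$ admits a meromorphic continuation to all $s\in\mathbb{C}$, and $$f_{m,r}(s)=2\,\frac{U_{m-\ell-1}(1-2s)+U_{\ell-1}(1-2s)}{T_m(1-2s)-1}+\frac{1}{ms}.$$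
   Context: $T_n$ and $U_n$ denote the Chebyshev polynomials of the first and second kind, i.e. the polynomials with $T_n(\cos\theta)=\cos(n\theta)$ and $U_n(\cos\theta)\sin\theta=\sin((n+1)\theta)$ (so $T_0=U_0=1$), with the convention $U_{-1}\equiv 0$. $\csc=1/\sin$. *)

theory Defs
  imports "HOL-Complex_Analysis.Complex_Analysis" "HOL-Number_Theory.Cong"
begin

definition Cheb_T :: "nat \<Rightarrow> complex poly" where
  "Cheb_T n = (THE p. \<forall>\<theta>::real. poly p (of_real (cos \<theta>)) = of_real (cos (real n * \<theta>)))"

(* Indexed by int so that index -1 is available; the defining identity itself gives U_{-1} = 0. *)
definition Cheb_U :: "int \<Rightarrow> complex poly" where
  "Cheb_U k = (THE p. \<forall>\<theta>::real. poly p (of_real (cos \<theta>)) * of_real (sin \<theta>)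
                                 = of_real (sin (real_of_int (k + 1) * \<theta>)))"

lemma poly_eq_on_cos:
  fixes p q :: "complex poly"
  assumes "\<And>\<theta>::real. 0 < \<theta> \<Longrightarrow> \<theta> < pi \<Longrightarrow> poly p (of_real (cos \<theta>)) = poly q (of_real (cos \<theta>))"
  shows "p = q"
proof (rule ccontr)
  assume "p \<noteq> q"
  then have fin: "finite {x. poly (p - q) x = 0}"
    by (intro poly_roots_finite) auto
  have "inj_on (\<lambda>\<theta>. complex_of_real (cos \<theta>)) {0<..<pi}"
    by (intro inj_onI) (auto intro: cos_inj_pi)
  moreover have "infinite {0<..<pi}"
    by (simp add: infinite_Ioo)
  ultimately have "infinite ((\<lambda>\<theta>. complex_of_real (cos \<theta>)) ` {0<..<pi})"
    by (simp add: finite_image_iff)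
  moreover have "(\<lambda>\<theta>. complex_of_real (cos \<theta>)) ` {0<..<pi} \<subseteq> {x. poly (p - q) x = 0}"
    using assms by auto
  ultimately show False
    using fin finite_subset by blast
qed

lemma Cheb_T_ex1:
  "\<exists>!p::complex poly. \<forall>\<theta>::real. poly p (of_real (cos \<theta>)) = of_real (cos (real n * \<theta>))"
proof (rule ex_ex1I)
  show "\<exists>p::complex poly. \<forall>\<theta>::real. poly p (of_real (cos \<theta>)) = of_real (cos (real n * \<theta>))"
  proof (induction n rule: less_induct)
    case (less n)
    consider "n = 0" | "n = 1" | k where "n = Suc (Suc k)"
      by (cases n; cases "n - 1") auto
    then show ?case
    proof cases
      case 1
      then show ?thesis by (intro exI[of _ 1]) simp
    next
      case 2
      then show ?thesis by (intro exI[of _ "[:0, 1:]"]) simp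
    next
      case (3 k)
      obtain p q :: "complex poly"
        where p: "\<And>\<theta>::real. poly p (of_real (cos \<theta>)) = of_real (cos (real (Suc k) * \<theta>))"
          and q: "\<And>\<theta>::real. poly q (of_real (cos \<theta>)) = of_real (cos (real k * \<theta>))"
        using less[of k] less[of "Suc k"] 3 by auto
      have rec: "cos (real n * \<theta>) = 2 * cos \<theta> * cos (real (Suc k) * \<theta>) - cos (real k * \<theta>)" for \<theta>
      proof -
        have "real n * \<theta> = real (Suc k) * \<theta> + \<theta>" "real k * \<theta> = real (Suc k) * \<theta> - \<theta>"
          using 3 by (auto simp: algebra_simps)
        then show ?thesis by (simp only: cos_add cos_diff) simp
      qed
      show ?thesis
        by (intro exI[of _ "[:0, 2:] * p - q"]) (simp add: p q rec)
    qed
  qed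
next
  fix p q :: "complex poly"
  assume "\<forall>\<theta>::real. poly p (of_real (cos \<theta>)) = of_real (cos (real n * \<theta>))"
    and "\<forall>\<theta>::real. poly q (of_real (cos \<theta>)) = of_real (cos (real n * \<theta>))"
  then show "p = q" by (intro poly_eq_on_cos) auto
qed

lemma Cheb_U_ex1:
  "\<exists>!p::complex poly. \<forall>\<theta>::real. poly p (of_real (cos \<theta>)) * of_real (sin \<theta>)
                                  = of_real (sin (real_of_int (k + 1) * \<theta>))"
proof (rule ex_ex1I)
  have nonneg: "\<exists>p::complex poly. \<forall>\<theta>::real. poly p (of_real (cos \<theta>)) * of_real (sin \<theta>)
                                  = of_real (sin (real n * \<theta>))" for n
  proof (induction n rule: less_induct)
    case (less n)
    consider "n = 0" | "n = 1" | k where "n = Suc (Suc k)"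
      by (cases n; cases "n - 1") auto
    then show ?case
    proof cases
      case 1
      then show ?thesis by (intro exI[of _ 0]) simp
    next
      case 2
      then show ?thesis by (intro exI[of _ 1]) simp
    next
      case (3 k)
      obtain p q :: "complex poly"
        where p: "\<And>\<theta>::real. poly p (of_real (cos \<theta>)) * of_real (sin \<theta>) = of_real (sin (real (Suc k) * \<theta>))"
          and q: "\<And>\<theta>::real. poly q (of_real (cos \<theta>)) * of_real (sin \<theta>) = of_real (sin (real k * \<theta>))"
        using less[of k] less[of "Suc k"] 3 by auto
      have rec: "sin (real n * \<theta>) = 2 * cos \<theta> * sin (real (Suc k) * \<theta>) - sin (real k * \<theta>)" for \<theta>
      proof -
        have "real n * \<theta> = real (Suc k) * \<theta> + \<theta>" "real k * \<theta> = real (Suc k) * \<theta> - \<theta>"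
          using 3 by (auto simp: algebra_simps)
        then show ?thesis by (simp only: sin_add sin_diff) simp
      qed
      have "poly ([:0, 2:] * p - q) (of_real (cos \<theta>)) * of_real (sin \<theta>)
              = complex_of_real (sin (real n * \<theta>))" for \<theta>
      proof -
        have "poly ([:0, 2:] * p - q) (of_real (cos \<theta>)) * of_real (sin \<theta>)
              = 2 * of_real (cos \<theta>) * (poly p (of_real (cos \<theta>)) * of_real (sin \<theta>))
                - poly q (of_real (cos \<theta>)) * complex_of_real (sin \<theta>)"
          by (simp add: algebra_simps)
        then show ?thesis by (simp only: p q rec) simp
      qed
      then show ?thesis by blast
    qed
  qed
  show "\<exists>p::complex poly. \<forall>\<theta>::real. poly p (of_real (cos \<theta>)) * of_real (sin \<theta>)
                                  = of_real (sin (real_of_int (k + 1) * \<theta>))"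
  proof (cases "k + 1 \<ge> 0")
    case True
    then show ?thesis using nonneg[of "nat (k + 1)"] by simp
  next
    case False
    obtain p :: "complex poly" where
      "\<And>\<theta>::real. poly p (of_real (cos \<theta>)) * of_real (sin \<theta>) = of_real (sin (real (nat (- (k + 1))) * \<theta>))"
      using nonneg[of "nat (- (k + 1))"] by auto
    moreover have "sin (real (nat (- (k + 1))) * \<theta>) = - sin (real_of_int (k + 1) * \<theta>)" for \<theta>
    proof -
      have "real (nat (- (k + 1))) * \<theta> = - (real_of_int (k + 1) * \<theta>)"
        using False by (simp add: algebra_simps)
      then show ?thesis by (simp only: sin_minus)
    qed
    ultimately show ?thesis by (intro exI[of _ "- p"]) simp
  qed
next
  fix p q :: "complex poly"
  assume p: "\<forall>\<theta>::real. poly p (of_real (cos \<theta>)) * of_real (sin \<theta>) = of_real (sin (real_of_int (k + 1) * \<theta>))"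
    and q: "\<forall>\<theta>::real. poly q (of_real (cos \<theta>)) * of_real (sin \<theta>) = of_real (sin (real_of_int (k + 1) * \<theta>))"
  show "p = q"
  proof (rule poly_eq_on_cos)
    fix \<theta> :: real assume "0 < \<theta>" "\<theta> < pi"
    then have "complex_of_real (sin \<theta>) \<noteq> 0" using sin_gt_zero by force
    moreover have "poly p (of_real (cos \<theta>)) * of_real (sin \<theta>) = poly q (of_real (cos \<theta>)) * of_real (sin \<theta>)"
      using p q by simp
    ultimately show "poly p (of_real (cos \<theta>)) = poly q (of_real (cos \<theta>))" by simp
  qed
qed

lemma poly_Cheb_T_cos:
  "poly (Cheb_T n) (of_real (cos \<theta>)) = of_real (cos (real n * \<theta>))"
  using theI'[OF Cheb_T_ex1[of n]] unfolding Cheb_T_def by blast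

lemma poly_Cheb_U_cos:
  "poly (Cheb_U k) (of_real (cos \<theta>)) * of_real (sin \<theta>) = of_real (sin (real_of_int (k + 1) * \<theta>))"
  using theI'[OF Cheb_U_ex1[of k]] unfolding Cheb_U_def by blast

lemma Cheb_U_minus_one: "Cheb_U (-1) = 0"
  using Cheb_U_ex1[of "-1"] poly_Cheb_U_cos[of "-1"] by auto

definition csc :: "real \<Rightarrow> real" where
  "csc x = 1 / sin x"

definition csc_sum_shift :: "nat \<Rightarrow> int \<Rightarrow> real \<Rightarrow> nat \<Rightarrow> complex" where
  "csc_sum_shift m r \<beta> n =
     (1 / of_nat m) * (\<Sum>j = 0..m - 1. of_real (csc ((real j + \<beta>) / real m * pi) ^ (2 * n))
                          * exp (2 * of_real pi * \<i> * of_int r * of_nat j / of_nat m))"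

definition csc_sum :: "nat \<Rightarrow> int \<Rightarrow> nat \<Rightarrow> complex" where
  "csc_sum m r n =
     (1 / of_nat m) * (\<Sum>j = 1..m - 1. of_real (csc (real j / real m * pi) ^ (2 * n))
                          * exp (2 * of_real pi * \<i> * of_int r * of_nat j / of_nat m))"

definition csc_gf_shift :: "nat \<Rightarrow> int \<Rightarrow> real \<Rightarrow> complex \<Rightarrow> complex" where
  "csc_gf_shift m r \<beta> s = (\<Sum>n. csc_sum_shift m r \<beta> (n + 1) * s ^ n)"

definition csc_gf :: "nat \<Rightarrow> int \<Rightarrow> complex \<Rightarrow> complex" where
  "csc_gf m r s = (\<Sum>n. csc_sum m r (n + 1) * s ^ n)"

end

(* With z = 1 - 2s and \<phi>_j = 2\<pi>(j + \<beta>)/m, the double-angle formula turns 1/(sin\<^sup>2(\<phi>_j/2) - s)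
   into 2/(z - cos \<phi>_j), so summing geometric series expresses the generating function as a
   finite sum of these fractions. To evaluate it, put w = exp(i \<phi>_j) and q = w^m, which does not
   depend on j. The sequence a(k) = U_(m-k-1)(z) + q U_(k-1)(z) satisfies
   a(k+1) + a(k-1) = 2z a(k) and its discrete Fourier transform telescopes:
   (z - cos \<phi>_j) \<Sum>k<m. a(k) w^(-k) = T_m(z) - cos 2\<pi>\<beta>.
   Fourier inversion gives the closed form, with no case distinction for repeated roots of
   T_m(z) - cos 2\<pi>\<beta>. For \<beta> = 0 the term j = 0 is -1/(ms). *)

theory Submission
  imports Defs
begin

section \<open>Chebyshev identities at integer indices\<close>

lemma Cheb_U_rec:
  "poly (Cheb_U (k + 1)) x = 2 * x * poly (Cheb_U k) x - poly (Cheb_U (k - 1)) x"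
proof -
  have "Cheb_U (k + 1) = [:0, 2:] * Cheb_U k - Cheb_U (k - 1)"
  \<comment> \<open>It suffices to compare values at cos \<theta> for 0 < \<theta> < pi. There sin
    \<theta> can be cancelled, so the claim becomes the addition formula for sin((k + 1)\<theta>
    \<plusminus> \<theta>), with no sign condition on \<open>k\<close>.\<close>
  proof (rule poly_eq_on_cos)
    fix \<theta> :: real
    assume \<theta>: "0 < \<theta>" "\<theta> < pi"
    let ?c = "complex_of_real (cos \<theta>)" and ?s = "complex_of_real (sin \<theta>)"
    have s: "?s \<noteq> 0" using sin_gt_zero[OF \<theta>] by simp
    have sines: "sin (real_of_int (k + 1 + 1) * \<theta>)
        = 2 * cos \<theta> * sin (real_of_int (k + 1) * \<theta>) - sin (real_of_int (k - 1 + 1) * \<theta>)"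
    proof -
      have "real_of_int (k + 1 + 1) * \<theta> = real_of_int (k + 1) * \<theta> + \<theta>"
        "real_of_int (k - 1 + 1) * \<theta> = real_of_int (k + 1) * \<theta> - \<theta>"
        by (auto simp: algebra_simps)
      then show ?thesis by (simp only: sin_add sin_diff) simp
    qed
    have "poly (Cheb_U (k + 1)) ?c * ?s
        = 2 * ?c * (poly (Cheb_U k) ?c * ?s) - poly (Cheb_U (k - 1)) ?c * ?s"
      by (simp only: poly_Cheb_U_cos sines) simp
    also have "\<dots> = poly ([:0, 2:] * Cheb_U k - Cheb_U (k - 1)) ?c * ?s"
      by (simp add: algebra_simps)
    finally show "poly (Cheb_U (k + 1)) ?c = poly ([:0, 2:] * Cheb_U k - Cheb_U (k - 1)) ?c"
      using s by simp
  qed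
  then show ?thesis by simp
qed

lemma Cheb_U_0: "Cheb_U 0 = 1"
proof (rule poly_eq_on_cos)
  fix \<theta> :: real
  assume \<theta>: "0 < \<theta>" "\<theta> < pi"
  then have "sin \<theta> \<noteq> 0" using sin_gt_zero by force
  then show "poly (Cheb_U 0) (of_real (cos \<theta>)) = poly 1 (of_real (cos \<theta>))"
    using poly_Cheb_U_cos[of 0 \<theta>] by simp
qed

text \<open>This comes from 2 cos(m \<theta>) sin \<theta> = sin((m + 1)\<theta>) - sin((m -
  1)\<theta>). It recognises the boundary terms of the telescoping sum below as a multiple of
  T_m.\<close>

lemma Cheb_T_conv_U: "2 * poly (Cheb_T m) x = poly (Cheb_U (int m)) x - poly (Cheb_U (int m - 2)) x"
proof -
  have "[:2:] * Cheb_T m = Cheb_U (int m) - Cheb_U (int m - 2)"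
  proof (rule poly_eq_on_cos)
    fix \<theta> :: real
    assume \<theta>: "0 < \<theta>" "\<theta> < pi"
    let ?c = "complex_of_real (cos \<theta>)" and ?s = "complex_of_real (sin \<theta>)"
    have s: "?s \<noteq> 0" using sin_gt_zero[OF \<theta>] by simp
    have sines: "2 * cos (real m * \<theta>) * sin \<theta>
        = sin (real_of_int (int m + 1) * \<theta>) - sin (real_of_int (int m - 2 + 1) * \<theta>)"
    proof -
      have "real_of_int (int m + 1) * \<theta> = real m * \<theta> + \<theta>"
        "real_of_int (int m - 2 + 1) * \<theta> = real m * \<theta> - \<theta>"
        by (auto simp: algebra_simps)
      then show ?thesis by (simp only: sin_add sin_diff)
    qed
    have "poly ([:2:] * Cheb_T m) ?c * ?s = of_real (2 * cos (real m * \<theta>) * sin \<theta>)"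
      by (simp add: poly_Cheb_T_cos)
    also have "\<dots> = poly (Cheb_U (int m)) ?c * ?s - poly (Cheb_U (int m - 2)) ?c * ?s"
      by (simp only: poly_Cheb_U_cos sines of_real_diff)
    also have "\<dots> = poly (Cheb_U (int m) - Cheb_U (int m - 2)) ?c * ?s"
      by (simp add: algebra_simps)
    finally show "poly ([:2:] * Cheb_T m) ?c = poly (Cheb_U (int m) - Cheb_U (int m - 2)) ?c"
      using s by simp
  qed
  from arg_cong[OF this, of "\<lambda>p. poly p x"] show ?thesis by simp
qed

section \<open>The numerator sequence and its telescoping Fourier transform\<close>

definition cheb_num :: "nat \<Rightarrow> complex \<Rightarrow> complex \<Rightarrow> int \<Rightarrow> complex" where
  "cheb_num m q z l = poly (Cheb_U (int m - l - 1)) z + q * poly (Cheb_U (l - 1)) z"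

text \<open>The three-term recurrence of U is unchanged when the index is reversed, so U_(m-k-1)
  satisfies it in k just as U_(k-1) does, and so does any linear combination.\<close>

lemma cheb_num_rec: "cheb_num m q z (k + 1) + cheb_num m q z (k - 1) = 2 * z * cheb_num m q z k"
proof -
  have "poly (Cheb_U (int m - (k - 1) - 1)) z
      = 2 * z * poly (Cheb_U (int m - k - 1)) z - poly (Cheb_U (int m - (k + 1) - 1)) z"
    using Cheb_U_rec[of "int m - k - 1" z] by (simp add: algebra_simps)
  moreover have "poly (Cheb_U (k + 1 - 1)) z = 2 * z * poly (Cheb_U (k - 1)) z - poly (Cheb_U (k - 1 - 1)) z"
    using Cheb_U_rec[of "k - 1" z] by simp
  ultimately show ?thesis
    unfolding cheb_num_def by (simp only:) (simp add: algebra_simps)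
qed

lemma cheb_num_transform:
  fixes w z :: complex and m :: nat
  assumes w: "w \<noteq> 0"
  defines "q \<equiv> w ^ m"
  shows "(2 * z - w - 1 / w) * (\<Sum>k<m. cheb_num m q z (int k) / w ^ k)
    = 2 * poly (Cheb_T m) z - q - 1 / q"
proof -
  let ?a = "cheb_num m q z"
  \<comment> \<open>\<open>G k\<close> is the Casoratian (discrete Wronskian) of \<open>?a\<close>
    and k \<mapsto> w^(-k). These sequences solve three-term recurrences with coefficients 2z and w
    + 1/w, so its increment is the difference of the coefficients times the product of the
    sequences. At k = 0 it involves index -1, which is why \<open>cheb_num\<close> takes an integer
    index.\<close>
  define G where "G k = (w * ?a (int k) - ?a (int k - 1)) / w ^ k" for k
  have step: "(2 * z - w - 1 / w) * (?a (int k) / w ^ k) = G (Suc k) - G k" for k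
  proof -
    have "2 * z * ?a (int k) = ?a (int k + 1) + ?a (int k - 1)"
      by (rule cheb_num_rec[symmetric])
    moreover have "int (Suc k) = int k + 1" by simp
    ultimately show ?thesis
      using w unfolding G_def by (simp add: field_simps)
  qed
  have "(2 * z - w - 1 / w) * (\<Sum>k<m. ?a (int k) / w ^ k) = (\<Sum>k<m. G (Suc k) - G k)"
    by (simp only: sum_distrib_left step)
  also have "\<dots> = G m - G 0"
    by (rule sum_lessThan_telescope)
  \<comment> \<open>Both ends contain the term w U_(m-1)(z), at the upper end because q/w^m = 1, and
    these cancel. What survives is -1/q - U_(m-2) from \<open>G m\<close> and q - U_m from
    \<open>G 0\<close>.\<close>
  also have "\<dots> = poly (Cheb_U (int m)) z - poly (Cheb_U (int m - 2)) z - q - 1 / q"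
  proof -
    \<comment> \<open>This value enters through \<open>?a (-1)\<close> = U_m + q U_(-2) and produces
      the term -q.\<close>
    have "poly (Cheb_U (-2)) z = -1"
    proof -
      have "poly (Cheb_U (-2)) z = 2 * z * poly (Cheb_U (-1)) z - poly (Cheb_U 0) z"
        using Cheb_U_rec[of "-1" z] by (simp add: algebra_simps)
      then show ?thesis by (simp add: Cheb_U_0 Cheb_U_minus_one)
    qed
    moreover have "q \<noteq> 0" using w by (simp add: q_def)
    ultimately show ?thesis
      by (simp add: G_def cheb_num_def Cheb_U_0 Cheb_U_minus_one q_def[symmetric] field_simps)
  qed
  finally show ?thesis by (simp add: Cheb_T_conv_U)
qed

section \<open>Orthogonality of roots of unity and Fourier inversion\<close>

lemma sum_roots_unity_ratio:
  fixes m k l :: nat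
  assumes "k < m" "l < m"
  shows "(\<Sum>j<m. cis (2 * pi * real j / real m) ^ l / cis (2 * pi * real j / real m) ^ k)
    = (if k = l then of_nat m else 0)"
proof (cases "k = l")
  case True
  then show ?thesis by simp
next
  case False
  let ?e = "\<lambda>i. exp (2 * of_real pi * \<i> * of_nat i / of_nat m)"
  let ?x = "?e l / ?e k"
  have e: "cis (2 * pi * real j / real m) ^ i = ?e i ^ j" for i j
    by (simp add: cis_conv_exp exp_of_nat_mult[symmetric] mult_ac)
  have m: "m > 0" using assms by simp
  \<comment> \<open>Distinct \<open>k\<close> and \<open>l\<close> below \<open>m\<close> are
    incongruent mod \<open>m\<close>, so \<open>?x\<close> is an m-th root of unity other than 1 and
    its geometric sum vanishes.\<close>
  have "?x \<noteq> 1"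
    using complex_root_unity_eq[of m l k] False assms m by (simp add: Cong.cong_def)
  moreover have "?e i ^ m = 1" for i
    using complex_root_unity[of m i] m by simp
  then have "?x ^ m = 1" by (simp only: power_divide) simp
  ultimately have "(\<Sum>j<m. ?x ^ j) = 0"
    by (simp add: geometric_sum)
  with False show ?thesis by (simp only: e power_divide if_False)
qed

lemma cheb_partial_fractions:
  fixes \<beta> :: real and z :: complex
  assumes l: "l < m" and D: "poly (Cheb_T m) z \<noteq> of_real (cos (2 * pi * \<beta>))"
  shows "\<And>j. z \<noteq> of_real (cos (2 * pi * (real j + \<beta>) / real m))"
    and "(\<Sum>j<m. cis (2 * pi * real j / real m) ^ l / (z - of_real (cos (2 * pi * (real j + \<beta>) / real m))))
      = of_nat m * cis (- (2 * pi * \<beta> * real l / real m)) * cheb_num m (cis (2 * pi * \<beta>)) z (int l)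
          / (poly (Cheb_T m) z - of_real (cos (2 * pi * \<beta>)))"
proof -
  let ?D = "poly (Cheb_T m) z - of_real (cos (2 * pi * \<beta>))"
  let ?q = "cis (2 * pi * \<beta>)"
  let ?a = "cheb_num m ?q z"
  let ?\<phi> = "\<lambda>j. 2 * pi * (real j + \<beta>) / real m"
  let ?\<omega> = "\<lambda>j. cis (2 * pi * real j / real m)"
  \<comment> \<open>The phase common to all j: exp(i \<phi>_j) is a root of unity
    \<open>?\<omega> j\<close> times \<open>v\<close>. The factor v^(-l) left after inversion is the
    exponential in front of the closed form.\<close>
  define v where "v = cis (2 * pi * \<beta> / real m)"
  have m: "m > 0" using l by simp
  have two_cos: "cis t + 1 / cis t = 2 * of_real (cos t)" for t
  proof -
    have "1 / cis t = cis (- t)" by (simp add: divide_inverse)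
    then show ?thesis by (simp only: complex_eq_iff) simp
  qed
  have wv: "cis (?\<phi> j) = ?\<omega> j * v" for j
    by (simp add: v_def cis_mult ring_distribs add_divide_distrib)
  have wm: "cis (?\<phi> j) ^ m = ?q" for j
    using m cis_multiple_2pi[of "real j"] by (simp only: wv v_def power_mult_distrib Complex.DeMoivre) simp
  have key: "(z - of_real (cos (?\<phi> j))) * (\<Sum>k<m. ?a (int k) / cis (?\<phi> j) ^ k) = ?D" for j
  proof -
    have double: "2 * x - cis t - 1 / cis t = 2 * (x - of_real (cos t))" for x t
      using two_cos[of t] by (simp only: right_diff_distrib diff_diff_eq)
    show ?thesis
      using cheb_num_transform[of "cis (?\<phi> j)" z m]
      unfolding wm double by (simp only: mult.assoc mult_cancel_left) simp
  qed
  \<comment> \<open>By \<open>key\<close>, z - cos \<phi>_j is a factor of \<open>?D\<close>, so a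
    nonzero \<open>?D\<close> rules out all the poles at once.\<close>
  show nz: "z \<noteq> of_real (cos (?\<phi> j))" for j
    using key[of j] D by auto
  have "?\<omega> j ^ l / (z - of_real (cos (?\<phi> j)))
      = (\<Sum>k<m. ?a (int k) / v ^ k * (?\<omega> j ^ l / ?\<omega> j ^ k)) / ?D" for j
  proof -
    have quotient: "x / X = x * S / D" if "X * S = D" "D \<noteq> 0" for x X S D :: complex
      using that by (auto simp: field_simps)
    have "?\<omega> j ^ l / (z - of_real (cos (?\<phi> j)))
        = ?\<omega> j ^ l * (\<Sum>k<m. ?a (int k) / cis (?\<phi> j) ^ k) / ?D"
      using D by (intro quotient[OF key]) simp
    also have "?\<omega> j ^ l * (\<Sum>k<m. ?a (int k) / cis (?\<phi> j) ^ k)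
        = (\<Sum>k<m. ?a (int k) / v ^ k * (?\<omega> j ^ l / ?\<omega> j ^ k))"
      unfolding sum_distrib_left by (intro sum.cong refl) (simp only: wv power_mult_distrib, simp add: mult_ac)
    finally show ?thesis .
  qed
  then have "(\<Sum>j<m. ?\<omega> j ^ l / (z - of_real (cos (?\<phi> j))))
      = (\<Sum>k<m. ?a (int k) / v ^ k * (\<Sum>j<m. ?\<omega> j ^ l / ?\<omega> j ^ k)) / ?D"
    by (simp only: sum_divide_distrib[symmetric] sum_distrib_left)
      (subst sum.swap, rule refl)
  \<comment> \<open>Summing over j first, orthogonality keeps only the coefficient k = l.\<close>
  also have "\<dots> = (\<Sum>k<m. if k = l then ?a (int k) / v ^ k * of_nat m else 0) / ?D"
    using l by (intro arg_cong2[where f = "(/)"] sum.cong) (auto simp: sum_roots_unity_ratio)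
  also have "\<dots> = of_nat m * (?a (int l) / v ^ l) / ?D"
    using l by (simp add: mult_ac)
  also have "?a (int l) / v ^ l = cis (- (2 * pi * \<beta> * real l / real m)) * ?a (int l)"
    by (simp only: v_def Complex.DeMoivre divide_inverse cis_inverse) (simp add: mult_ac divide_inverse)
  finally show "(\<Sum>j<m. ?\<omega> j ^ l / (z - of_real (cos (?\<phi> j))))
      = of_nat m * cis (- (2 * pi * \<beta> * real l / real m)) * ?a (int l) / ?D"
    by (simp add: mult_ac)
qed

section \<open>Generating functions that are finite sums of simple fractions\<close>

lemma rational_generating_function:
  fixes a c :: "'i \<Rightarrow> complex" and C :: "nat \<Rightarrow> complex"
  assumes J: "finite J" and a: "\<And>j. j \<in> J \<Longrightarrow> a j \<noteq> 0"
    and C: "\<And>n. C n = (\<Sum>j\<in>J. c j / a j ^ (n + 1))"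
  shows "\<exists>R>0. uniform_limit (ball 0 R) (\<lambda>N s. \<Sum>n<N. C n * s ^ n) (\<lambda>s. \<Sum>n. C n * s ^ n) sequentially
    \<and> (\<forall>s\<in>ball 0 R. summable (\<lambda>n. norm (C n * s ^ n)))
    \<and> (\<exists>F. F nicely_meromorphic_on UNIV \<and> (\<forall>s\<in>ball 0 R. F s = (\<Sum>n. C n * s ^ n))
        \<and> (\<forall>s. s \<notin> a ` J \<longrightarrow> F s = (\<Sum>j\<in>J. c j / (a j - s))))"
proof -
  \<comment> \<open>Inserting 1 keeps the minimum meaningful for empty \<open>J\<close>.\<close>
  define \<delta> where "\<delta> = Min (insert 1 ((norm \<circ> a) ` J))"
  have \<delta>: "\<delta> > 0"
    using J a by (auto simp: \<delta>_def)
  have \<delta>_le: "\<delta> \<le> norm (a j)" if "j \<in> J" for j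
    using J that by (auto simp: \<delta>_def intro: Min_le)
  \<comment> \<open>Half the distance bound makes every ratio s / a_j at most 1/2 in norm on the
    whole ball, so one geometric majorant serves both the M-test and absolute convergence.\<close>
  define R where "R = \<delta> / 2"
  have R: "R > 0" using \<delta> by (simp add: R_def)
  define M where "M n = (\<Sum>j\<in>J. norm (c j) / norm (a j)) * (1 / 2) ^ n" for n :: nat
  have M: "summable M"
    unfolding M_def by (intro summable_mult summable_geometric) simp
  have ratio: "norm (s / a j) \<le> 1 / 2" if "j \<in> J" "s \<in> ball 0 R" for s j
    using that \<delta>_le[of j] a[of j] by (simp add: norm_divide R_def field_simps)
  have term_eq: "C n * s ^ n = (\<Sum>j\<in>J. c j / a j * (s / a j) ^ n)" for n s
    by (simp add: C sum_distrib_right power_divide)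
  have bound: "norm (C n * s ^ n) \<le> M n" if "s \<in> ball 0 R" for n s
  proof -
    have "norm (C n * s ^ n) \<le> (\<Sum>j\<in>J. norm (c j / a j * (s / a j) ^ n))"
      unfolding term_eq by (rule norm_sum)
    also have "\<dots> \<le> (\<Sum>j\<in>J. norm (c j) / norm (a j) * (1 / 2) ^ n)"
      unfolding norm_mult norm_power norm_divide[of "c _"]
      by (intro sum_mono mult_left_mono power_mono ratio that) auto
    finally show ?thesis by (simp only: M_def sum_distrib_right)
  qed
  define g where "g s = (\<Sum>j\<in>J. c j / (a j - s))" for s
  have sums: "(\<lambda>n. C n * s ^ n) sums g s" if s: "s \<in> ball 0 R" for s
    unfolding term_eq g_def
  proof (rule sums_sum)
    fix j assume j: "j \<in> J"
    have "norm (s / a j) < 1" using ratio[OF j s] by linarith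
    from sums_mult[OF geometric_sums[OF this], of "c j / a j"]
    show "(\<lambda>n. c j / a j * (s / a j) ^ n) sums (c j / (a j - s))"
      using a[OF j] by (simp add: field_simps)
  qed
  have off: "s \<notin> a ` J" if "s \<in> ball 0 R" for s
    using that \<delta>_le \<delta> by (force simp: R_def)
  have ana: "g analytic_on {s}" if "s \<notin> a ` J" for s
    using that unfolding g_def by (auto intro!: analytic_intros)
  have "remove_sings g nicely_meromorphic_on UNIV"
    unfolding g_def by (intro remove_sings_nicely_meromorphic) (auto intro!: meromorphic_intros)
  moreover have "\<forall>s. s \<notin> a ` J \<longrightarrow> remove_sings g s = g s"
    using ana by simp
  moreover from this have "\<forall>s\<in>ball 0 R. remove_sings g s = (\<Sum>n. C n * s ^ n)"
    using off sums by (simp add: sums_iff)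
  moreover have "uniform_limit (ball 0 R) (\<lambda>N s. \<Sum>n<N. C n * s ^ n) (\<lambda>s. \<Sum>n. C n * s ^ n) sequentially"
    using bound M by (intro Weierstrass_m_test)
  moreover have "\<forall>s\<in>ball 0 R. summable (\<lambda>n. norm (C n * s ^ n))"
    using bound by (auto intro: summable_comparison_test'[OF M])
  ultimately show ?thesis
    using R unfolding g_def by blast
qed

section \<open>From cosecant sums to partial fractions\<close>

lemma exp_root_unity_cong:
  fixes r :: int and l m j :: nat
  assumes m: "m > 0" and lr: "[int l = r] (mod int m)"
  shows "exp (2 * of_real pi * \<i> * of_int r * of_nat j / of_nat m) = cis (2 * pi * real j / real m) ^ l"
proof -
  \<comment> \<open>Replacing \<open>r\<close> by \<open>l\<close> changes the exponent by k j times
    2 pi i, which the exponential does not see.\<close>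
  from lr obtain k where k: "r = int l + int m * k"
    by (auto simp: cong_iff_lin)
  have "exp (2 * of_real pi * \<i> * of_int r * of_nat j / of_nat m)
      = exp (of_nat l * (\<i> * of_real (2 * pi * real j / real m))) * exp (of_int (k * int j) * (2 * pi * \<i>))"
    using m unfolding k exp_add[symmetric] by (intro arg_cong[where f = exp]) (simp add: field_simps)
  also have "exp (of_int (k * int j) * (2 * pi * \<i>)) = 1"
    using exp_integer_2pi[of "of_int (k * int j)"] by (simp add: mult_ac)
  finally show ?thesis by (simp only: exp_of_nat_mult cis_conv_exp mult_1_right)
qed

lemma csc_power_even: "csc x ^ (2 * n) = 1 / (sin x ^ 2) ^ n"
  by (simp add: csc_def power_mult power_one_over power_divide)

text \<open>This is where the argument 1 - 2s comes from: a pole at s = sin^2 x corresponds to z =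
  cos 2x.\<close>

lemma sin_squared_diff:
  "complex_of_real (sin x ^ 2) - s = ((1 - 2 * s) - of_real (cos (2 * x))) / 2"
  unfolding cos_double_sin by simp

text \<open>The partial fractions in the variable s = (1 - z)/2. Here \<beta> is any real number, so
  that \<beta> = 0 can serve the unshifted sum.\<close>

lemma cheb_partial_fractions_csc:
  fixes \<beta> :: real and s :: complex
  assumes "l < m" "poly (Cheb_T m) (1 - 2 * s) - of_real (cos (2 * pi * \<beta>)) \<noteq> 0"
  shows "\<And>j. of_real (sin ((real j + \<beta>) / real m * pi) ^ 2) \<noteq> s"
    and "(\<Sum>j<m. cis (2 * pi * real j / real m) ^ l / of_nat m / (of_real (sin ((real j + \<beta>) / real m * pi) ^ 2) - s))
      = 2 * cis (- (2 * pi * \<beta> * real l / real m)) * cheb_num m (cis (2 * pi * \<beta>)) (1 - 2 * s) (int l)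
          / (poly (Cheb_T m) (1 - 2 * s) - of_real (cos (2 * pi * \<beta>)))"
proof -
  note * = cheb_partial_fractions[of l m "1 - 2 * s" \<beta>]
  let ?d = "\<lambda>j. 1 - 2 * s - complex_of_real (cos (2 * pi * (real j + \<beta>) / real m))"
  have diff: "of_real (sin ((real j + \<beta>) / real m * pi) ^ 2) - s = ?d j / 2" for j
    unfolding sin_squared_diff by (simp add: mult_ac)
  show "of_real (sin ((real j + \<beta>) / real m * pi) ^ 2) \<noteq> s" for j
  proof -
    have "?d j / 2 \<noteq> 0" using *(1)[of j] assms by simp
    then show ?thesis unfolding diff[symmetric] by (simp only: right_minus_eq not_False_eq_True)
  qed
  have "(\<Sum>j<m. cis (2 * pi * real j / real m) ^ l / of_nat m / (of_real (sin ((real j + \<beta>) / real m * pi) ^ 2) - s))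
      = 2 / of_nat m * (\<Sum>j<m. cis (2 * pi * real j / real m) ^ l / ?d j)"
    unfolding diff sum_distrib_left by (simp add: mult_ac)
  also have "\<dots> = 2 * cis (- (2 * pi * \<beta> * real l / real m)) * cheb_num m (cis (2 * pi * \<beta>)) (1 - 2 * s) (int l)
          / (poly (Cheb_T m) (1 - 2 * s) - of_real (cos (2 * pi * \<beta>)))"
    using assms by (subst *(2)) auto
  finally show "(\<Sum>j<m. cis (2 * pi * real j / real m) ^ l / of_nat m / (of_real (sin ((real j + \<beta>) / real m * pi) ^ 2) - s)) = \<dots>" .
qed

lemma sin_shift_nonzero:
  assumes "m > 0" "\<beta> \<notin> \<int>"
  shows "sin ((real j + \<beta>) / real m * pi) \<noteq> 0"
proof
  assume "sin ((real j + \<beta>) / real m * pi) = 0"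
  then obtain i :: int where "(real j + \<beta>) / real m = of_int i"
    by (auto simp only: sin_zero_iff_int2 mult_cancel_right pi_neq_zero)
  then have "\<beta> = of_int (i * int m - int j)"
    using assms(1) by (simp add: field_simps)
  with assms(2) show False by simp
qed

text \<open>Brings the coefficients into the form expected by
  \<open>rational_generating_function\<close>, with poles sin^2 and weights that are roots of unity
  divided by m.\<close>

lemma csc_sum_shift_eq:
  assumes "m > 0" "[int l = r] (mod int m)"
  shows "csc_sum_shift m r \<beta> n
    = (\<Sum>j<m. cis (2 * pi * real j / real m) ^ l / of_nat m / of_real (sin ((real j + \<beta>) / real m * pi) ^ 2) ^ n)"
proof -
  have "{0..m - 1} = {..<m}" using assms by auto
  then show ?thesis
    unfolding csc_sum_shift_def exp_root_unity_cong[OF assms] csc_power_even sum_distrib_left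
    by (intro sum.cong) (simp_all add: mult_ac)
qed

lemma csc_sum_eq:
  assumes "m > 0" "[int l = r] (mod int m)"
  shows "csc_sum m r n
    = (\<Sum>j\<in>{1..<m}. cis (2 * pi * real j / real m) ^ l / of_nat m / of_real (sin (real j / real m * pi) ^ 2) ^ n)"
proof -
  have "{1..m - 1} = {1..<m}" using assms by auto
  then show ?thesis
    unfolding csc_sum_def exp_root_unity_cong[OF assms] csc_power_even sum_distrib_left
    by (intro sum.cong) (simp_all add: mult_ac)
qed

section \<open>The shifted and unshifted generating functions\<close>

theorem theorem1p1:
  fixes m l :: nat and r :: int
  assumes "m > 1"
    and "r \<in> {- (int m - 1)..int m - 1}"
    and "l \<in> {0..m - 1}"
    and "[int l = r] (mod int m)"
  shows
    "(\<forall>\<beta>::real. \<beta> > 0 \<longrightarrow> \<beta> \<notin> \<int> \<longrightarrow>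
       (\<exists>R>0.
          uniform_limit (ball 0 R) (\<lambda>N s. \<Sum>n<N. csc_sum_shift m r \<beta> (n + 1) * s ^ n)
            (csc_gf_shift m r \<beta>) sequentially \<and>
          (\<forall>s \<in> ball 0 R. summable (\<lambda>n. norm (csc_sum_shift m r \<beta> (n + 1) * s ^ n))) \<and>
          (\<exists>F. F nicely_meromorphic_on UNIV \<and>
               (\<forall>s \<in> ball 0 R. F s = csc_gf_shift m r \<beta> s) \<and>
               (\<forall>s. poly (Cheb_T m) (1 - 2 * s) - of_real (cos (2 * pi * \<beta>)) \<noteq> 0 \<longrightarrow>
                  F s = 2 * exp (- 2 * of_real pi * \<i> * of_real \<beta> * of_nat l / of_nat m) *
                    ((poly (Cheb_U (int m - int l - 1)) (1 - 2 * s)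
                       + exp (2 * of_real pi * \<i> * of_real \<beta>) * poly (Cheb_U (int l - 1)) (1 - 2 * s))
                     / (poly (Cheb_T m) (1 - 2 * s) - of_real (cos (2 * pi * \<beta>))))))))
     \<and>
     (\<exists>R>0.
        uniform_limit (ball 0 R) (\<lambda>N s. \<Sum>n<N. csc_sum m r (n + 1) * s ^ n)
          (csc_gf m r) sequentially \<and>
        (\<forall>s \<in> ball 0 R. summable (\<lambda>n. norm (csc_sum m r (n + 1) * s ^ n))) \<and>
        (\<exists>F. F nicely_meromorphic_on UNIV \<and>
             (\<forall>s \<in> ball 0 R. F s = csc_gf m r s) \<and>
             (\<forall>s. s \<noteq> 0 \<longrightarrow> poly (Cheb_T m) (1 - 2 * s) - 1 \<noteq> 0 \<longrightarrow>
                F s = 2 * ((poly (Cheb_U (int m - int l - 1)) (1 - 2 * s)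
                             + poly (Cheb_U (int l - 1)) (1 - 2 * s))
                           / (poly (Cheb_T m) (1 - 2 * s) - 1))
                      + 1 / (of_nat m * s))))"
proof (intro conjI allI impI)
  have m: "m > 0" and l: "l < m" using assms by auto
  note eqs = csc_sum_shift_eq[OF m assms(4)] csc_sum_eq[OF m assms(4)]
  let ?c = "\<lambda>j. cis (2 * pi * real j / real m) ^ l / complex_of_nat m"
  {
    fix \<beta> :: real
    assume \<beta>: "\<beta> > 0" "\<beta> \<notin> \<int>"
    let ?a = "\<lambda>j. complex_of_real (sin ((real j + \<beta>) / real m * pi) ^ 2)"
    \<comment> \<open>Both halves are needed: avoiding the possible poles makes the continuation
      equal to the finite sum at \<open>s\<close>, and the sum then has the closed form.\<close>
    have formula: "s \<notin> ?a ` {..<m} \<and> (\<Sum>j<m. ?c j / (?a j - s))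
        = 2 * exp (- 2 * of_real pi * \<i> * of_real \<beta> * of_nat l / of_nat m) *
                    ((poly (Cheb_U (int m - int l - 1)) (1 - 2 * s)
                       + exp (2 * of_real pi * \<i> * of_real \<beta>) * poly (Cheb_U (int l - 1)) (1 - 2 * s))
                     / (poly (Cheb_T m) (1 - 2 * s) - of_real (cos (2 * pi * \<beta>))))"
      if "poly (Cheb_T m) (1 - 2 * s) - of_real (cos (2 * pi * \<beta>)) \<noteq> 0" for s
    proof -
      have "exp (- 2 * of_real pi * \<i> * of_real \<beta> * of_nat l / of_nat m) = cis (- (2 * pi * \<beta> * real l / real m))"
        "exp (2 * of_real pi * \<i> * of_real \<beta>) = cis (2 * pi * \<beta>)"
        by (simp_all add: cis_conv_exp mult_ac)
      with cheb_partial_fractions_csc[OF l that] show ?thesis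
        by (auto simp: cheb_num_def)
    qed
    have "?a j \<noteq> 0" for j
      using sin_shift_nonzero[OF m \<beta>(2), of j] by simp
    from rational_generating_function[of "{..<m}" ?a "\<lambda>n. csc_sum_shift m r \<beta> (n + 1)" ?c, OF _ this eqs(1)]
    obtain R F where "R > 0"
        "uniform_limit (ball 0 R) (\<lambda>N s. \<Sum>n<N. csc_sum_shift m r \<beta> (n + 1) * s ^ n) (csc_gf_shift m r \<beta>) sequentially"
        "\<forall>s\<in>ball 0 R. summable (\<lambda>n. norm (csc_sum_shift m r \<beta> (n + 1) * s ^ n))"
        "F nicely_meromorphic_on UNIV" "\<forall>s\<in>ball 0 R. F s = csc_gf_shift m r \<beta> s"
        "\<forall>s. s \<notin> ?a ` {..<m} \<longrightarrow> F s = (\<Sum>j<m. ?c j / (?a j - s))"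
      unfolding csc_gf_shift_def[abs_def] by blast
    with formula show "\<exists>R>0.
          uniform_limit (ball 0 R) (\<lambda>N s. \<Sum>n<N. csc_sum_shift m r \<beta> (n + 1) * s ^ n)
            (csc_gf_shift m r \<beta>) sequentially \<and>
          (\<forall>s \<in> ball 0 R. summable (\<lambda>n. norm (csc_sum_shift m r \<beta> (n + 1) * s ^ n))) \<and>
          (\<exists>F. F nicely_meromorphic_on UNIV \<and>
               (\<forall>s \<in> ball 0 R. F s = csc_gf_shift m r \<beta> s) \<and>
               (\<forall>s. poly (Cheb_T m) (1 - 2 * s) - of_real (cos (2 * pi * \<beta>)) \<noteq> 0 \<longrightarrow>
                  F s = 2 * exp (- 2 * of_real pi * \<i> * of_real \<beta> * of_nat l / of_nat m) *
                    ((poly (Cheb_U (int m - int l - 1)) (1 - 2 * s)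
                       + exp (2 * of_real pi * \<i> * of_real \<beta>) * poly (Cheb_U (int l - 1)) (1 - 2 * s))
                     / (poly (Cheb_T m) (1 - 2 * s) - of_real (cos (2 * pi * \<beta>))))))"
      by (intro exI[of _ R] exI[of _ F] conjI) simp_all
  }
  let ?a = "\<lambda>j. complex_of_real (sin (real j / real m * pi) ^ 2)"
  have formula: "s \<notin> ?a ` {1..<m} \<and> (\<Sum>j\<in>{1..<m}. ?c j / (?a j - s))
      = 2 * ((poly (Cheb_U (int m - int l - 1)) (1 - 2 * s) + poly (Cheb_U (int l - 1)) (1 - 2 * s))
              / (poly (Cheb_T m) (1 - 2 * s) - 1)) + 1 / (of_nat m * s)"
    if s: "s \<noteq> 0" and D: "poly (Cheb_T m) (1 - 2 * s) - 1 \<noteq> 0" for s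
  proof -
    have D': "poly (Cheb_T m) (1 - 2 * s) - of_real (cos (2 * pi * 0)) \<noteq> 0"
      using D by simp
    \<comment> \<open>The partial fractions at \<beta> = 0 also run over j = 0, where the sine
      vanishes. That term is (1/m)/(0 - s), and moving it to the other side gives the summand
      1/(ms).\<close>
    have "{..<m} = insert 0 {1..<m}" using m by auto
    then have "(\<Sum>j<m. ?c j / (?a j - s)) = (\<Sum>j\<in>{1..<m}. ?c j / (?a j - s)) - 1 / (of_nat m * s)"
      by simp
    with cheb_partial_fractions_csc[OF l D'] show ?thesis
      by (auto simp: cheb_num_def algebra_simps)
  qed
  have "?a j \<noteq> 0" if "j \<in> {1..<m}" for j
  proof -
    \<comment> \<open>Leaving out j = 0 keeps the angle strictly between 0 and pi, so no
      \<open>?a j\<close> vanishes.\<close>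
    have "sin (real j / real m * pi) > 0"
      using that by (intro sin_gt_zero) (auto simp: field_simps)
    then show ?thesis by simp
  qed
  from rational_generating_function[of "{1..<m}" ?a "\<lambda>n. csc_sum m r (n + 1)" ?c, OF _ this eqs(2)]
  obtain R F where "R > 0"
        "uniform_limit (ball 0 R) (\<lambda>N s. \<Sum>n<N. csc_sum m r (n + 1) * s ^ n) (csc_gf m r) sequentially"
        "\<forall>s\<in>ball 0 R. summable (\<lambda>n. norm (csc_sum m r (n + 1) * s ^ n))"
        "F nicely_meromorphic_on UNIV" "\<forall>s\<in>ball 0 R. F s = csc_gf m r s"
        "\<forall>s. s \<notin> ?a ` {1..<m} \<longrightarrow> F s = (\<Sum>j\<in>{1..<m}. ?c j / (?a j - s))"
      unfolding csc_gf_def[abs_def] by blast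
  with formula show "\<exists>R>0.
        uniform_limit (ball 0 R) (\<lambda>N s. \<Sum>n<N. csc_sum m r (n + 1) * s ^ n)
          (csc_gf m r) sequentially \<and>
        (\<forall>s \<in> ball 0 R. summable (\<lambda>n. norm (csc_sum m r (n + 1) * s ^ n))) \<and>
        (\<exists>F. F nicely_meromorphic_on UNIV \<and>
             (\<forall>s \<in> ball 0 R. F s = csc_gf m r s) \<and>
             (\<forall>s. s \<noteq> 0 \<longrightarrow> poly (Cheb_T m) (1 - 2 * s) - 1 \<noteq> 0 \<longrightarrow>
                F s = 2 * ((poly (Cheb_U (int m - int l - 1)) (1 - 2 * s)
                             + poly (Cheb_U (int l - 1)) (1 - 2 * s))
                           / (poly (Cheb_T m) (1 - 2 * s) - 1))
                      + 1 / (of_nat m * s)))"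
    by (intro exI[of _ R] exI[of _ F] conjI) simp_all
qed

end
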